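(* Let $n\ge 3$ be an integer and let $S=\{i_1,i_2,\dots,i_k\}\subseteq[n]$ with $i_1<i_2<\dots<i_k$. Then $CP_n(S)\neq\emptyset$ if and only if $i_j\ge 2j+1$ for all $j\in[k]$.
   Context: $[n]=\{1,\dots,n\}$ and $\mathfrak S_n$ is the set of permutations of $[n]$, written in one-line notation $\sigma=\sigma(1)\sigma(2)\cdots\sigma(n)$. The circular peak set of $\sigma$ is $CP(\sigma)=\{\sigma(i)\mid 2\le i\le n-1,\ \sigma(i-1)<\sigma(i)>\sigma(i+1)\}$. For $S\subseteq[n]$, $CP_n(S)=\{\sigma\in\mathfrak S_n\mid CP(\sigma)=S\}$. *)

theory Defs
  imports "HOL-Combinatorics.Permutations"
begin

text \<open>
  Permutations of \<open>[n]\<close> are functions on \<^typ>\<open>nat\<close> that permute \<open>{1..n}\<close>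
  (and are the identity elsewhere). The peak set consists of peak values
  \<open>\<sigma> i\<close>, not of peak positions \<open>i\<close>; only interior positions count.
\<close>

definition circular_peak_set :: "nat \<Rightarrow> (nat \<Rightarrow> nat) \<Rightarrow> nat set" where
  "circular_peak_set n \<sigma> =
     {\<sigma> i | i. 2 \<le> i \<and> i \<le> n - 1 \<and> \<sigma> (i - 1) < \<sigma> i \<and> \<sigma> i > \<sigma> (i + 1)}"

definition CP :: "nat \<Rightarrow> nat set \<Rightarrow> (nat \<Rightarrow> nat) set" where
  "CP n S = {\<sigma>. \<sigma> permutes {1..n} \<and> circular_peak_set n \<sigma> = S}"

end

theory Submission
  imports Defs "HOL-Library.Infinite_Set"
begin

text \<open>
  Necessity: the peaks with value at most \<open>v = i j\<close> occupy \<open>j\<close> pairwise non-adjacent positions, so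
  together with their neighbours they occupy at least \<open>2 * j + 1\<close> positions, all carrying values
  in \<open>{1..v}\<close>.

  Sufficiency: list the non-peaks as \<open>a 0 < a 1 < \<dots>\<close> and take the word
  \<open>a 0, i 1, a 1, i 2, \<dots>, i k, a k, a (k + 1), \<dots>\<close>. The hypothesis \<open>i j \<ge> 2 * j + 1\<close> says
  that there are more than \<open>j\<close> non-peaks below \<open>i j\<close>, that is, \<open>a j < i j\<close>.
\<close>

lemma card_peak_neighbourhood:
  fixes f :: "nat \<Rightarrow> nat"
  assumes "finite P" "P \<noteq> {}"
    and peak: "\<And>p. p \<in> P \<Longrightarrow> 1 \<le> p \<and> f (p - 1) < f p \<and> f (p + 1) < f p"
  shows "2 * card P + 1 \<le> card (P \<union> Suc ` P \<union> (\<lambda>p. p - 1) ` P)"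
proof -
  let ?m = "Min P - 1"
  have m: "Min P \<in> P" "\<And>p. p \<in> P \<Longrightarrow> Min P \<le> p" "1 \<le> Min P"
    using assms by auto
  have "Suc p \<notin> P" if "p \<in> P" for p
    using peak[of p] peak[of "Suc p"] that by auto
  then have "P \<inter> Suc ` P = {}"
    by auto
  then have "card (P \<union> Suc ` P) = 2 * card P"
    using assms(1) by (simp add: card_Un_disjoint card_image)
  moreover have "?m \<notin> P \<union> Suc ` P"
    using m by fastforce
  ultimately have "2 * card P + 1 = card (insert ?m (P \<union> Suc ` P))"
    using assms(1) by simp
  also have "\<dots> \<le> card (P \<union> Suc ` P \<union> (\<lambda>p. p - 1) ` P)"
    using assms(1) m(1) by (intro card_mono) auto
  finally show ?thesis .
qed

text \<open>A neighbour of a peak carries a smaller value than the peak, so the injective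
  \<open>\<sigma>\<close> maps the whole neighbourhood of the peaks of value at most
  \<open>v\<close> into \<open>{1..v}\<close>.\<close>

lemma peak_value_lower_bound:
  assumes perm: "\<sigma> permutes {1..n}"
    and V: "V \<subseteq> circular_peak_set n \<sigma>" "V \<noteq> {}" "\<And>x. x \<in> V \<Longrightarrow> x \<le> v"
  shows "2 * card V + 1 \<le> v"
proof -
  \<comment> \<open>\<open>P\<close> takes all peak positions of value at most \<open>v\<close>,
    possibly more than those realising \<open>V\<close>; \<open>card V \<le> card P\<close>
    suffices.\<close>
  define P where "P = {p. 2 \<le> p \<and> p \<le> n - 1 \<and> \<sigma> (p - 1) < \<sigma> p \<and> \<sigma> (p + 1) < \<sigma> p \<and> \<sigma> p \<le> v}"
  let ?N = "P \<union> Suc ` P \<union> (\<lambda>p. p - 1) ` P"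
  have fin: "finite P"
    by (rule finite_subset[of _ "{..n}"]) (auto simp: P_def)
  have "V \<subseteq> \<sigma> ` P"
    using V(1,3) by (fastforce simp: circular_peak_set_def P_def)
  then have "card V \<le> card P" "P \<noteq> {}"
    using fin V(2) by (auto dest: surj_card_le)
  have "2 * card P + 1 \<le> card ?N"
    using fin \<open>P \<noteq> {}\<close> by (rule card_peak_neighbourhood[where f = \<sigma>]) (auto simp: P_def)
  also have "\<dots> = card (\<sigma> ` ?N)"
    using permutes_inj[OF perm] by (metis card_image inj_on_subset subset_UNIV)
  also have "\<dots> \<le> card {1..v}"
  proof (rule card_mono)
    have "?N \<subseteq> {1..n}"
      by (auto simp: P_def)
    then have "\<sigma> ` ?N \<subseteq> {1..n}"
      using permutes_image[OF perm] by blast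
    moreover have "\<sigma> ` ?N \<subseteq> {..v}"
      by (auto simp: P_def)
    moreover have "{1..n} \<inter> {..v} \<subseteq> {1..v}"
      by auto
    ultimately show "\<sigma> ` ?N \<subseteq> {1..v}"
      by blast
  qed simp
  finally show ?thesis
    using \<open>card V \<le> card P\<close> by simp
qed

lemma CP_nonempty:
  fixes i :: "nat \<Rightarrow> nat"
  assumes sub: "i ` {1..k} \<subseteq> {1..n}"
    and mono: "strict_mono_on {1..k} i"
    and ge: "\<And>j. j \<in> {1..k} \<Longrightarrow> 2 * j + 1 \<le> i j"
    and "1 \<le> n"
  shows "CP n (i ` {1..k}) \<noteq> {}"
proof -
  let ?S = "i ` {1..k}"
  let ?T = "{1..n} - ?S"
  \<comment> \<open>For \<open>k > 0\<close> this is \<open>2 * k + 1 \<le> i k \<le> n\<close>. It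
    leaves at least \<open>k + 1\<close> non-peaks, so \<open>a 0, ..., a k\<close> all
    exist.\<close>
  have nk: "2 * k + 1 \<le> n"
  proof (cases "k = 0")
    case False
    then have "i k \<in> {1..n}"
      by (intro subsetD[OF sub]) auto
    with ge[of k] False show ?thesis
      by auto
  qed (use \<open>1 \<le> n\<close> in simp)
  have "card ?S = k"
    using strict_mono_on_imp_inj_on[OF mono] by (simp add: card_image)
  then have card_T: "card ?T = n - k"
    using sub by (simp add: card_Diff_subset)
  obtain a where a: "bij_betw a {..<n - k} ?T" and a_mono: "strict_mono_on {..<n - k} a"
    using ex_bij_betw_strict_mono_card[of ?T] card_T by auto
  have a_less: "a x < a y" if "x < y" "y < n - k" for x y
    using a_mono that by (auto simp: strict_mono_on_def)
  have a_range: "a ` {..<n - k} = ?T"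
    using a by (simp add: bij_betw_def)
  have a_below: "a j < i j" if j: "j \<in> {1..k}" for j
  proof (rule ccontr)
    assume *: "\<not> a j < i j"
    \<comment> \<open>If \<open>i j \<le> a j\<close>, every value below \<open>i j\<close> is some
      \<open>a m\<close> or \<open>i m\<close> with \<open>m < j\<close>. There are at most
      \<open>j + (j - 1)\<close> of these, yet \<open>i j - 1 \<ge> 2 * j\<close>.\<close>
    have "{1..<i j} \<subseteq> a ` {..<j} \<union> i ` {1..<j}"
    proof
      fix x assume x: "x \<in> {1..<i j}"
      moreover have "i j \<in> {1..n}"
        using sub j by blast
      ultimately have "x \<in> a ` {..<n - k} \<union> ?S"
        unfolding a_range by auto
      then consider m where "x = a m" "m < n - k" | m where "x = i m" "m \<in> {1..k}"
        by auto
      then show "x \<in> a ` {..<j} \<union> i ` {1..<j}"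
      proof cases
        case 1
        then have "m < j"
          using a_less[of j m] * x by (cases m j rule: linorder_cases) auto
        then show ?thesis using 1 by auto
      next
        case 2
        then have "m < j"
          using strict_mono_onD[OF mono, of j m] j x by (cases m j rule: linorder_cases) auto
        then show ?thesis using 2 by auto
      qed
    qed
    then have "card {1..<i j} \<le> card (a ` {..<j} \<union> i ` {1..<j})"
      by (intro card_mono) auto
    also have "\<dots> \<le> card {..<j} + card {1..<j}"
      by (intro order_trans[OF card_Un_le] add_mono card_image_le) auto
    finally show False
      using ge[OF j] j by auto
  qed
  \<comment> \<open>Position \<open>2 * j\<close> gets \<open>i j\<close> and position
    \<open>2 * j + 1\<close> gets \<open>a j\<close>. The tail formula agrees with this at
    \<open>p = 2 * k + 1\<close>, where \<open>p - k - 1 = k\<close>.\<close>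
  define \<sigma> where "\<sigma> p =
    (if p = 0 \<or> n < p then p
     else if p \<le> 2 * k then (if even p then i (p div 2) else a (p div 2))
     else a (p - k - 1))" for p
  have \<sigma>_even: "\<sigma> (2 * j) = i j" if "j \<in> {1..k}" for j
    using that nk by (auto simp: \<sigma>_def)
  have \<sigma>_odd: "\<sigma> (2 * j + 1) = a j" if "j \<le> k" for j
    using that nk by (cases "j = k") (auto simp: \<sigma>_def)
  have \<sigma>_tail: "\<sigma> p = a (p - k - 1)" if "2 * k < p" "p \<le> n" for p
    using that by (auto simp: \<sigma>_def)
  have surj: "{1..n} \<subseteq> \<sigma> ` {1..n}"
  proof
    fix x assume "x \<in> {1..n}"
    then have "x \<in> a ` {..<n - k} \<union> ?S"
      unfolding a_range by auto
    then consider m where "x = a m" "m < n - k" "m \<le> k" | m where "x = a m" "m < n - k" "k < m"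
      | m where "x = i m" "m \<in> {1..k}"
      by fastforce
    then show "x \<in> \<sigma> ` {1..n}"
    proof cases
      case 1
      then show ?thesis using \<sigma>_odd[of m] nk by (intro image_eqI[of _ _ "2 * m + 1"]) auto
    next
      case 2
      then show ?thesis using \<sigma>_tail[of "m + k + 1"] by (intro image_eqI[of _ _ "m + k + 1"]) auto
    next
      case 3
      then show ?thesis using \<sigma>_even[of m] nk by (intro image_eqI[of _ _ "2 * m"]) auto
    qed
  qed
  \<comment> \<open>The image has at most \<open>n\<close> elements and contains
    \<open>{1..n}\<close>; equal cardinalities then also give injectivity.\<close>
  then have eq: "\<sigma> ` {1..n} = {1..n}"
    by (metis card_image_le card_seteq finite_atLeastAtMost finite_imageI)
  then have "bij_betw \<sigma> {1..n} {1..n}"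
    by (simp add: bij_betw_def eq_card_imp_inj_on)
  then have perm: "\<sigma> permutes {1..n}"
    by (rule bij_imp_permutes) (auto simp: \<sigma>_def)
  have "circular_peak_set n \<sigma> = ?S"
  proof (intro equalityI subsetI)
    fix x assume "x \<in> circular_peak_set n \<sigma>"
    then obtain p where p: "x = \<sigma> p" "2 \<le> p" "p \<le> n - 1" "\<sigma> (p + 1) < \<sigma> p"
      by (auto simp: circular_peak_set_def)
    \<comment> \<open>Beyond position \<open>2 * k\<close> the word is increasing, so no descent can
      start there.\<close>
    have "p \<le> 2 * k"
      using p a_less[of "p - k - 1" "p - k"] \<sigma>_tail[of p] \<sigma>_tail[of "p + 1"] by fastforce
    \<comment> \<open>At an odd position \<open>2 * j + 1\<close> below \<open>2 * k\<close> the
      next entry is larger: \<open>a j < a (Suc j) < i (Suc j)\<close>.\<close>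
    moreover have "even p"
    proof (rule ccontr)
      assume "odd p"
      then obtain j where j: "p = 2 * j + 1"
        by (elim oddE)
      then have "Suc j \<in> {1..k}"
        using \<open>p \<le> 2 * k\<close> by auto
      then have "a j < i (Suc j)"
        using a_less[of j "Suc j"] a_below[of "Suc j"] nk by force
      then show False
        using p j \<sigma>_odd[of j] \<sigma>_even[of "Suc j"] \<open>Suc j \<in> {1..k}\<close> by auto
    qed
    then obtain j where "p = 2 * j" ..
    ultimately show "x \<in> ?S"
      using p \<sigma>_even[of j] by auto
  next
    fix x assume "x \<in> ?S"
    then obtain j where j: "x = i j" "j \<in> {1..k}"
      by auto
    \<comment> \<open>Both neighbours of \<open>i j\<close> are smaller, because
      \<open>a (j - 1) < a j < i j\<close>.\<close>
    then have "a (j - 1) < i j"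
      using a_less[of "j - 1" j] a_below[of j] nk by force
    moreover have "\<sigma> (2 * j - 1) = a (j - 1)"
      using \<sigma>_odd[of "j - 1"] j by (cases j) auto
    moreover have "\<sigma> (2 * j + 1) = a j"
      using \<sigma>_odd[of j] j by auto
    ultimately have "\<sigma> (2 * j - 1) < \<sigma> (2 * j)" "\<sigma> (2 * j + 1) < \<sigma> (2 * j)"
      using j a_below[of j] \<sigma>_even[of j] by auto
    then show "x \<in> circular_peak_set n \<sigma>"
      using j \<sigma>_even[of j] nk
      by (auto simp: circular_peak_set_def intro!: exI[of _ "2 * j"])
  qed
  with perm show ?thesis
    by (auto simp: CP_def)
qed

theorem theorem2p1:
  fixes n k :: nat and S :: "nat set" and i :: "nat \<Rightarrow> nat"
  assumes "n \<ge> 3"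
    and "S \<subseteq> {1..n}"
    and "S = i ` {1..k}"
    and "strict_mono_on {1..k} i"
  shows "CP n S \<noteq> {} \<longleftrightarrow> (\<forall>j\<in>{1..k}. i j \<ge> 2 * j + 1)"
proof
  assume "CP n S \<noteq> {}"
  then obtain \<sigma> where \<sigma>: "\<sigma> permutes {1..n}" "circular_peak_set n \<sigma> = S"
    by (auto simp: CP_def)
  show "\<forall>j\<in>{1..k}. i j \<ge> 2 * j + 1"
  proof
    fix j assume j: "j \<in> {1..k}"
    have "inj_on i {1..j}"
      using strict_mono_on_imp_inj_on[OF assms(4)] j by (auto intro: inj_on_subset)
    then have "card (i ` {1..j}) = j"
      by (simp add: card_image)
    \<comment> \<open>The \<open>j\<close> smallest peak values are bounded by the largest of them,
      \<open>i j\<close>.\<close>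
    moreover have "2 * card (i ` {1..j}) + 1 \<le> i j"
    proof (rule peak_value_lower_bound[OF \<sigma>(1)])
      show "i ` {1..j} \<subseteq> circular_peak_set n \<sigma>"
        using j \<sigma>(2) assms(3) by auto
      show "x \<le> i j" if "x \<in> i ` {1..j}" for x
        using that j strict_mono_onD[OF assms(4)] by (fastforce simp: le_less)
    qed (use j in auto)
    ultimately show "i j \<ge> 2 * j + 1"
      by simp
  qed
next
  assume "\<forall>j\<in>{1..k}. i j \<ge> 2 * j + 1"
  then show "CP n S \<noteq> {}"
    using CP_nonempty[of i k n] assms by auto
qed

end
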